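(* Let $X$ be a path-connected and locally path-connected Hausdorff space such that for each $x \in X$ the subspace $X \setminus \{x\}$ has the Phragmen-Brouwer Property. Then for every arc $A$ in $X$, the complement $X \setminus A$ is path-connected.
   Context: An arc in a space $X$ is a subspace of $X$ homeomorphic to the unit interval $[0,1]$. A topological space $Y$ has the Phragmen-Brouwer Property (PBP) if $Y$ is connected and the following holds: if $D$ and $E$ are disjoint closed subsets of $Y$, and if $a$ and $b$ are points in $Y \setminus (D \cup E)$ which lie in the same connected component of $Y \setminus D$ and in the same connected component of $Y \setminus E$, then $a$ and $b$ lie in the same connected component of $Y \setminus (D \cup E)$. *)

theory Defs
  imports "HOL-Analysis.Analysis"
begin

definition arc_in :: "'a topology \<Rightarrow> 'a set \<Rightarrow> bool"
  where "arc_in X A \<longleftrightarrow>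
    A \<subseteq> topspace X \<and> subtopology X A homeomorphic_space top_of_set {0..1::real}"

definition phragmen_brouwer_property :: "'a topology \<Rightarrow> bool"
  where "phragmen_brouwer_property Y \<longleftrightarrow>
    connected_space Y \<and>
    (\<forall>D E a b.
       closedin Y D \<and> closedin Y E \<and> disjnt D E \<and>
       a \<in> topspace Y - (D \<union> E) \<and> b \<in> topspace Y - (D \<union> E) \<and>
       connected_component_of (subtopology Y (topspace Y - D)) a b \<and>
       connected_component_of (subtopology Y (topspace Y - E)) a b
       \<longrightarrow> connected_component_of (subtopology Y (topspace Y - (D \<union> E))) a b)"

end

theory Submission
  imports Defs
begin

text \<open>
  Suppose that two points of the complement of an arc are separated by the arc. Cut the arc at an
  interior point \<open>x\<close>: in \<open>X - {x}\<close> the two halves are disjoint closed sets, so by the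
  Phragmen--Brouwer property one of the halves still separates the points. Iterating this bisection
  yields arbitrarily short separating subarcs shrinking to a point \<open>p\<close>. But \<open>X - {p}\<close> is
  path-connected, and a path in it stays away from every sufficiently short subarc around \<open>p\<close>.
\<close>

text \<open>Deleting \<open>p\<close> makes \<open>C\<close> and \<open>D\<close> disjoint closed
  sets of the punctured space, where the Phragmen-Brouwer property applies. Because \<open>p\<close>
  lies in both sets, the complements of \<open>C\<close>, \<open>D\<close> and
  \<open>C \<union> D\<close> are the same whether taken in \<open>X\<close> or in the punctured
  space, so the conclusion carries back to \<open>X\<close>.\<close>

lemma phragmen_brouwer_property_glue:
  assumes pbp: "phragmen_brouwer_property (subtopology X (topspace X - {p}))"
    and C: "closedin X C" and D: "closedin X D" and CD: "C \<inter> D = {p}"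
    and a: "a \<in> topspace X - (C \<union> D)" and b: "b \<in> topspace X - (C \<union> D)"
    and abC: "connected_component_of (subtopology X (topspace X - C)) a b"
    and abD: "connected_component_of (subtopology X (topspace X - D)) a b"
  shows "connected_component_of (subtopology X (topspace X - (C \<union> D))) a b"
proof -
  define Y where "Y = subtopology X (topspace X - {p})"
  have top: "topspace Y = topspace X - {p}"
    by (auto simp: Y_def)
  have closed: "closedin Y (S - {p})" if "closedin X S" for S
  proof -
    have "S - {p} = S \<inter> (topspace X - {p})"
      using closedin_subset[OF that] by blast
    then show ?thesis
      unfolding Y_def closedin_subtopology using that by blast
  qed
  have sub: "subtopology Y (topspace Y - S) = subtopology X (topspace X - T)"
    if "T = insert p S" for S T
    unfolding top Y_def subtopology_subtopology
    by (rule arg_cong[where f = "subtopology X"]) (use that in auto)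
  have p: "p \<in> C" "p \<in> D"
    using CD by auto
  have "disjnt (C - {p}) (D - {p})"
    using CD by (auto simp: disjnt_iff)
  moreover have "a \<in> topspace Y - (C - {p} \<union> (D - {p}))" "b \<in> topspace Y - (C - {p} \<union> (D - {p}))"
    using a b CD by (auto simp: top)
  moreover have "connected_component_of (subtopology Y (topspace Y - (C - {p}))) a b"
    "connected_component_of (subtopology Y (topspace Y - (D - {p}))) a b"
    using abC abD sub[of C "C - {p}"] sub[of D "D - {p}"] CD by (simp_all add: insert_absorb p)
  ultimately have
    "connected_component_of (subtopology Y (topspace Y - (C - {p} \<union> (D - {p})))) a b"
    using pbp closed[OF C] closed[OF D]
    unfolding phragmen_brouwer_property_def Y_def[symmetric] by blast
  moreover have "C \<union> D = insert p (C - {p} \<union> (D - {p}))"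
    using CD by auto
  ultimately show ?thesis
    using sub by metis
qed

text \<open>With a parametrization, subarcs become images of intervals and can be bisected.\<close>

lemma arc_inE:
  assumes "arc_in X A"
  obtains h where "continuous_map (top_of_set {0..1::real}) X h" "inj_on h {0..1}" "h ` {0..1} = A"
proof -
  have "top_of_set {0..1::real} homeomorphic_space subtopology X A"
    using assms homeomorphic_space_sym unfolding arc_in_def by blast
  then obtain h where h: "homeomorphic_map (top_of_set {0..1::real}) (subtopology X A) h"
    unfolding homeomorphic_space by blast
  have "topspace (subtopology X A) = A"
    using assms by (auto simp: arc_in_def)
  then show ?thesis
    using that h
    by (auto simp: homeomorphic_eq_everything_map continuous_map_in_subtopology)
qed

text \<open>A path from \<open>a\<close> to \<open>b\<close> avoiding \<open>p\<close> has a compact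
  image \<open>K\<close>, which is closed in a Hausdorff space. Take \<open>U\<close> to be the
  complement of \<open>K\<close>: removing any \<open>S\<close> inside \<open>U\<close> leaves
  \<open>K\<close> intact, and \<open>K\<close> is connected.\<close>

lemma connected_component_of_Diff_closedin:
  assumes X: "locally_path_connected_space X" "Hausdorff_space X"
    and conn: "connected_space (subtopology X (topspace X - {p}))"
    and a: "a \<in> topspace X - {p}" and b: "b \<in> topspace X - {p}"
  obtains U where "openin X U" "p \<in> topspace X \<Longrightarrow> p \<in> U"
    "\<And>S. S \<subseteq> U \<Longrightarrow> connected_component_of (subtopology X (topspace X - S)) a b"
proof -
  define Y where "Y = subtopology X (topspace X - {p})"
  \<comment> \<open>Openness lets the punctured space inherit local path-connectedness, which
    upgrades its connectedness to path-connectedness.\<close>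
  have "openin X (topspace X - {p})"
    by (metis X(2) Hausdorff_imp_t1_space t1_space_openin_delete_alt openin_topspace)
  then have "locally_path_connected_space Y"
    unfolding Y_def using X(1) locally_path_connected_space_open_subset by blast
  then have "path_connected_space Y"
    using conn path_connected_eq_connected_space unfolding Y_def by blast
  moreover have "a \<in> topspace Y" "b \<in> topspace Y"
    using a b by (auto simp: Y_def)
  ultimately obtain g where g: "pathin Y g" "g 0 = a" "g 1 = b"
    unfolding path_connected_space_def by blast
  define K where "K = g ` {0..1}"
  have K: "compactin X K" "connectedin X K" "K \<subseteq> topspace X - {p}"
    using compactin_path_image[OF g(1)] connectedin_path_image[OF g(1)]
    by (auto simp: Y_def K_def compactin_subtopology connectedin_subtopology)
  have ab: "a \<in> K" "b \<in> K"
    using g(2,3) by (force simp: K_def)+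
  show ?thesis
  proof
    show "openin X (topspace X - K)"
      using K(1) X(2) compactin_imp_closedin by blast
    show "p \<in> topspace X - K" if "p \<in> topspace X"
      using K(3) that by blast
    show "connected_component_of (subtopology X (topspace X - S)) a b"
      if "S \<subseteq> topspace X - K" for S
      unfolding connected_component_of_def connectedin_subtopology
      using K ab that by blast
  qed
qed

theorem proposition4p3:
  fixes X :: "'a topology"
  assumes "path_connected_space X"
    and "locally_path_connected_space X"
    and "Hausdorff_space X"
    and "\<And>x. x \<in> topspace X \<Longrightarrow>
           phragmen_brouwer_property (subtopology X (topspace X - {x}))"
  shows "\<forall>A. arc_in X A \<longrightarrow> path_connected_space (subtopology X (topspace X - A))"
proof (intro allI impI)
  fix A
  assume "arc_in X A"
  then obtain h where h: "continuous_map (top_of_set {0..1::real}) X h"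
    and inj: "inj_on h {0..1}" and A: "h ` {0..1} = A"
    by (rule arc_inE)
  have h_top: "h x \<in> topspace X" if "x \<in> {0..1}" for x
    using continuous_map_image_subset_topspace[OF h] that by auto
  have closed: "closedin X (h ` {s..t})" if "0 \<le> s" "t \<le> 1" for s t
  proof -
    have "compactin (top_of_set {0..1}) {s..t}"
      using that by (simp add: compactin_subtopology)
    then show ?thesis
      using image_compactin[OF _ h] compactin_imp_closedin[OF assms(3)] by blast
  qed
  have "connected_component_of (subtopology X (topspace X - A)) a b"
    if a: "a \<in> topspace X - A" and b: "b \<in> topspace X - A" for a b
  proof -
    \<comment> \<open>The guard makes \<open>P\<close> vacuous on intervals sticking out of
      \<open>{0..1}\<close>; the local case below must also cover short intervals around the
      endpoints 0 and 1.\<close>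
    define P where "P s t \<longleftrightarrow> (0 \<le> s \<and> t \<le> 1 \<longrightarrow>
      connected_component_of (subtopology X (topspace X - h ` {s..t})) a b)" for s t
    have "P 0 1"
    \<comment> \<open>Bisection in positive form: non-separation passes from two adjacent intervals
      to their union, and holds on all short intervals around each point, hence on all of
      \<open>{0..1}\<close>.\<close>
    proof (induction rule: Bolzano[OF zero_le_one])
      case (1 s m t)
      show ?case
        unfolding P_def
      proof
        assume st: "0 \<le> s \<and> t \<le> 1"
        then have m: "m \<in> {0..1}" and split: "{s..t} = {s..m} \<union> {m..t}" "{s..m} \<inter> {m..t} = {m}"
          using 1 by auto
        \<comment> \<open>Injectivity makes the two subarcs meet in the single point
          \<open>h m\<close>, as gluing requires.\<close>
        have "h ` ({s..m} \<inter> {m..t}) = h ` {s..m} \<inter> h ` {m..t}"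
          by (rule inj_on_image_Int[OF inj]) (use st m in auto)
        then have "h ` {s..m} \<inter> h ` {m..t} = {h m}"
          unfolding split(2) by simp
        moreover have "h ` {s..m} \<union> h ` {m..t} \<subseteq> A"
          using st m A by auto
        ultimately show "connected_component_of (subtopology X (topspace X - h ` {s..t})) a b"
          unfolding split image_Un
          using 1 a b st m assms(4)[OF h_top[OF m]]
          by (intro phragmen_brouwer_property_glue[where p = "h m"] closed) (auto simp: P_def)
      qed
    next
      case (2 x)
      then have x: "x \<in> {0..1}"
        by simp
      have "connected_space (subtopology X (topspace X - {h x}))"
        using assms(4)[OF h_top[OF x]] by (simp add: phragmen_brouwer_property_def)
      moreover have "a \<in> topspace X - {h x}" "b \<in> topspace X - {h x}"
        using a b A x by auto
      ultimately obtain U where U: "openin X U" "h x \<in> U"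
        "\<And>S. S \<subseteq> U \<Longrightarrow> connected_component_of (subtopology X (topspace X - S)) a b"
        using connected_component_of_Diff_closedin[OF assms(2,3)] h_top[OF x] by metis
      \<comment> \<open>By continuity, parameters within some \<open>d\<close> of \<open>x\<close>
        map into \<open>U\<close>. An interval containing \<open>x\<close> of length below
        \<open>d\<close> has only such parameters, so its subarc lies in \<open>U\<close> and cannot
        separate \<open>a\<close> from \<open>b\<close>.\<close>
      have "openin (top_of_set {0..1}) {y \<in> {0..1}. h y \<in> U}"
        using openin_continuous_map_preimage[OF h U(1)] by simp
      then obtain d where d: "d > 0" "\<And>y. y \<in> {0..1} \<Longrightarrow> dist y x < d \<Longrightarrow> h y \<in> U"
        using x U(2) unfolding openin_euclidean_subtopology_iff by blast
      have "P s t" if "s \<le> x" "x \<le> t" "t - s < d" for s t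
        unfolding P_def
      proof
        assume "0 \<le> s \<and> t \<le> 1"
        then have "h ` {s..t} \<subseteq> U"
          using that by (auto intro!: d(2) simp: dist_real_def)
        then show "connected_component_of (subtopology X (topspace X - h ` {s..t})) a b"
          by (rule U(3))
      qed
      then show ?case
        using d(1) by blast
    qed
    then show ?thesis
      by (simp add: P_def A)
  qed
  then have "connected_space (subtopology X (topspace X - A))"
    by (simp add: connected_space_iff_connected_component)
  \<comment> \<open>The arc is closed, so its complement is open and locally path-connected; there
    connectedness gives path-connectedness.\<close>
  moreover have "openin X (topspace X - A)"
    using closed[of 0 1] by (auto simp: A)
  then have "locally_path_connected_space (subtopology X (topspace X - A))"
    using assms(2) locally_path_connected_space_open_subset by blast
  ultimately show "path_connected_space (subtopology X (topspace X - A))"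
    by (simp add: path_connected_eq_connected_space)
qed

end
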